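(* Let $z\mapsto\bar z=H(z,\varepsilon)=z+N(z)f(z)+\varepsilon G(z,\varepsilon)$ be a fast-slow map satisfying Assumptions 1 and 2 stated in the context, with critical manifold $S$. Then, at each point of $S$: (1) The subset of non-trivial eigenvalues of the $n\times n$ matrix $N\,Df|_S$ coincides with the set of eigenvalues of the $(n-k)\times(n-k)$ matrix $Df\,N|_S$. (2) The set of non-trivial multipliers $\mu_j$ of the Jacobian matrix $DH(z,0)=I_n+N(z)Df(z)$, $z\in S$, coincides with the set of eigenvalues of the $(n-k)\times(n-k)$ matrix $I_{n-k}+Df\,N|_S$.
   Context: Setting: $1\le k<n$, $z\in\mathbb R^n$, $\varepsilon\in[0,\varepsilon_0)$, $H$ is $C^r$-smooth ($r\ge1$), $N(z)$ is an $n\times(n-k)$ matrix, $f(z)\in\mathbb R^{n-k}$, $G(z,\varepsilon)\in\mathbb R^n$. Assumption 1 (fast-slow map): the level set $\{z:N(z)f(z)=0\}$ contains a connected $k$-dimensional regularly embedded submanifold $S$ of $\mathbb R^n$. Assumption 2 (factorisation): $N(z)$ has full column rank for all $z\in S$, $S=\{f=0\}$ (the critical manifold), and any zeros $z_\ast\notin S$ of $N(z)f(z)$ are isolated. The $(n-k)\times n$ matrix $Df|_S$ has full row rank. For $z\in S$ the matrix $I_n+N(z)Df(z)$ has $k$ (trivial) multipliers, i.e. eigenvalues, equal to $1$, with eigenvectors spanning $T_zS$; the remaining $n-k$ eigenvalues are the non-trivial multipliers $\mu_j(z)$. Correspondingly $N(z)Df(z)$ has $k$ trivial eigenvalues equal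 to $0$ with eigenvectors spanning $T_zS$, and the remaining $n-k$ eigenvalues are its non-trivial eigenvalues.
   Formalization: The formal statement additionally assumes that f is differentiable and N is continuous at each point of S; without continuity of N on S the formula DH(z,0)=I+N Df, and with it claim (2), can fail. *)

theory Defs
  imports
    "HOL-Analysis.Analysis"
    "HOL-Computational_Algebra.Computational_Algebra"
    "HOL-Library.Extended_Nat"
begin

text \<open>
  Derivatives are taken \<^emph>\<open>within\<close> the domain, so that the definition is also meaningful at the
  boundary \<open>\<epsilon> = 0\<close> of \<open>UNIV \<times> {0..<\<epsilon>\<^sub>0}\<close>. It is meant for domains on which such derivatives are unique
  (open sets, convex sets with nonempty interior).
\<close>

primrec C_diff_on ::
  "nat \<Rightarrow> 'a::real_normed_vector set \<Rightarrow> ('a \<Rightarrow> 'b::real_normed_vector) \<Rightarrow> bool" where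
  "C_diff_on 0 U f \<longleftrightarrow> continuous_on U f"
| "C_diff_on (Suc r) U f \<longleftrightarrow>
     (\<exists>f'. (\<forall>x\<in>U. (f has_derivative f' x) (at x within U)) \<and> (\<forall>v. C_diff_on r U (\<lambda>x. f' x v)))"

definition C_smooth_on ::
  "enat \<Rightarrow> 'a::real_normed_vector set \<Rightarrow> ('a \<Rightarrow> 'b::real_normed_vector) \<Rightarrow> bool" where
  "C_smooth_on r U f \<longleftrightarrow> (\<forall>j::nat. enat j \<le> r \<longrightarrow> C_diff_on j U f)"

text \<open>Regularly embedded submanifolds, by means of slice charts of the ambient space.\<close>

definition embedded_submanifold :: "enat \<Rightarrow> nat \<Rightarrow> 'a::euclidean_space set \<Rightarrow> bool" where
  "embedded_submanifold r k S \<longleftrightarrow>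
     (\<forall>p\<in>S. \<exists>U (V :: 'a set) \<phi> \<psi> L.
        open U \<and> p \<in> U \<and> open V \<and> homeomorphism U V \<phi> \<psi> \<and>
        C_smooth_on r U \<phi> \<and> C_smooth_on r V \<psi> \<and>
        subspace L \<and> dim L = k \<and> \<phi> ` (S \<inter> U) = L \<inter> V)"

definition assumption1 ::
  "enat \<Rightarrow> nat \<Rightarrow> (real^'n \<Rightarrow> real^'m^'n) \<Rightarrow> (real^'n \<Rightarrow> real^'m) \<Rightarrow> (real^'n) set \<Rightarrow> bool" where
  "assumption1 r k N f S \<longleftrightarrow>
     S \<subseteq> {z. N z *v f z = 0} \<and> connected S \<and> embedded_submanifold r k S"

definition assumption2 ::
  "(real^'n \<Rightarrow> real^'m^'n) \<Rightarrow> (real^'n \<Rightarrow> real^'m) \<Rightarrow> (real^'n) set \<Rightarrow> bool" where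
  "assumption2 N f S \<longleftrightarrow>
     (\<forall>z\<in>S. rank (N z) = CARD('m)) \<and>
     S = {z. f z = 0} \<and>
     (\<forall>z. z \<notin> S \<and> N z *v f z = 0 \<longrightarrow> z isolated_in {w. N w *v f w = 0}) \<and>
     (\<forall>z\<in>S. rank (jacobian f (at z)) = CARD('m))"

definition charpoly :: "'a::comm_ring_1^'n^'n \<Rightarrow> 'a poly" where
  "charpoly A = det (mat [:0, 1:] - map_matrix (\<lambda>a. [:a:]) A)"

text \<open>The complex eigenvalues of a real matrix, counted with algebraic multiplicity.\<close>

definition eigenvalues :: "real^'n^'n \<Rightarrow> complex multiset" where
  "eigenvalues A = proots (charpoly (map_matrix complex_of_real A))"

text \<open>
  What remains of the spectrum after removing \<open>k\<close> trivial eigenvalues equal to \<open>0\<close> (respectively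
  \<open>k\<close> trivial multipliers equal to \<open>1\<close>). Only \<open>k\<close> copies are removed, as further eigenvalues may
  take the same value. Multiset difference truncates, but an equation between one of these multisets
  for an \<open>n \<times> n\<close> matrix and the spectrum of an \<open>(n - k) \<times> (n - k)\<close> matrix can only hold, by
  cardinality, if all \<open>k\<close> copies were present.
\<close>

definition nontrivial_eigenvalues :: "nat \<Rightarrow> real^'n^'n \<Rightarrow> complex multiset" where
  "nontrivial_eigenvalues k A = eigenvalues A - replicate_mset k 0"

definition nontrivial_multipliers :: "nat \<Rightarrow> real^'n^'n \<Rightarrow> complex multiset" where
  "nontrivial_multipliers k A = eigenvalues A - replicate_mset k 1"

lemma poly_charpoly: "poly (charpoly A) x = det (mat x - A)"
proof -
  have "poly ((mat [:0, 1:] - map_matrix (\<lambda>a. [:a:]) A) $ i $ j) x = (mat x - A) $ i $ j" for i j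
    by (simp add: mat_def)
  then show ?thesis
    unfolding charpoly_def det_def by (simp add: poly_sum poly_prod)
qed

lemma det_eq_0_iff_eigenvector:
  fixes A :: "complex^'n^'n"
  shows "det (mat x - A) = 0 \<longleftrightarrow> (\<exists>v. v \<noteq> 0 \<and> A *v v = x *s v)"
proof -
  have "(mat x - A) *v v = x *s v - A *v v" for v
    by (simp add: vec_eq_iff matrix_vector_mult_def mat_def left_diff_distrib sum_subtractf
        if_distrib[of "\<lambda>a. a * _"] cong: if_cong)
  then show ?thesis
    using invertible_det_nz[of "mat x - A"]
    unfolding invertible_left_inverse matrix_left_invertible_ker by auto
qed

lemma charpoly_nonzero:
  fixes A :: "complex^'n^'n"
  shows "charpoly A \<noteq> 0"
proof
  assume "charpoly A = 0"
  have "linear ((*v) A)"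
    by (intro linearI) (simp_all add: matrix_vector_mult_def vec_eq_iff scaleR_sum_right distrib_left
        sum.distrib)
  then obtain B where B: "norm (A *v v) \<le> B * norm v" for v
    using linear_bounded by blast
  have "det (mat (of_real (\<bar>B\<bar> + 1)) - A) = 0"
    using \<open>charpoly A = 0\<close> poly_charpoly[of A] by (metis poly_0)
  then obtain v where v: "v \<noteq> 0" "A *v v = of_real (\<bar>B\<bar> + 1) *s v"
    unfolding det_eq_0_iff_eigenvector by blast
  have "complex_of_real c *s v = c *\<^sub>R v" for c
    by (simp add: vec_eq_iff scaleR_conv_of_real[where 'a = complex])
  then have "norm (A *v v) = (\<bar>B\<bar> + 1) * norm v"
    unfolding v(2) by (simp only: norm_scaleR)
  with B[of v] have "(\<bar>B\<bar> + 1) * norm v \<le> B * norm v" by simp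
  with v(1) show False by simp
qed

lemma in_eigenvalues_iff:
  "x \<in># eigenvalues A \<longleftrightarrow> (\<exists>v. v \<noteq> 0 \<and> map_matrix complex_of_real A *v v = x *s v)"
  by (simp add: eigenvalues_def charpoly_nonzero poly_charpoly det_eq_0_iff_eigenvector)

end

theory Submission
  imports Defs
begin

text \<open>
  Both spectral claims are instances of one determinant identity. For an \<open>n \<times> m\<close> matrix \<open>A\<close> and an
  \<open>m \<times> n\<close> matrix \<open>B\<close> over a commutative ring, \<open>x\<^sup>m det (x - A B) = x\<^sup>n det (x - B A)\<close>. To see this,
  multiply \<open>L = (1, 0; - B, x)\<close> and \<open>M = (x, A; B, 1)\<close> in the two possible orders: both products are
  block upper triangular, with diagonal blocks \<open>x, x - B A\<close> and \<open>x - A B, x\<close> respectively, and they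
  have the same determinant.

  Take the ring of complex polynomials, \<open>A = N z\<close>, \<open>B = Df z\<close> and \<open>n = m + k\<close>. With the indeterminate
  as \<open>x\<close>, cancelling \<open>x\<^sup>m\<close> says that the characteristic polynomial of \<open>N Df\<close> is \<open>x\<^sup>k\<close> times that of
  \<open>Df N\<close>, so the roots agree as multisets up to \<open>k\<close> additional zeros. With the indeterminate minus \<open>1\<close>
  as \<open>x\<close>, the determinants become the characteristic polynomials of \<open>1 + N Df\<close> and \<open>1 + Df N\<close>,
  and the additional factor contributes \<open>k\<close> roots equal to \<open>1\<close> (lemma \<open>eigenvalues_shifted_product\<close>).

  The formula for the Jacobian would be the product rule if \<open>N\<close> were differentiable. On \<open>S\<close> continuity
  of \<open>N\<close> is enough: \<open>f\<close> vanishes at \<open>z\<close>, so \<open>f w\<close> is of order \<open>w - z\<close>, and \<open>(N w - N z) f w\<close> is of smaller order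
  than \<open>w - z\<close> (lemma \<open>has_derivative_prod_vanishing\<close>).
\<close>

(* The dollar sign is to denote matrix entries only, not coefficients of formal power series. *)
no_notation fps_nth (infixl \<open>$\<close> 75)

section \<open>Determinants of block triangular matrices\<close>

definition block_matrix ::
  "'a^'n^'n \<Rightarrow> 'a^'m^'n \<Rightarrow> 'a^'n^'m \<Rightarrow> 'a^'m^'m \<Rightarrow> 'a^('n + 'm)^('n + 'm)" where
  "block_matrix A B C D = (\<chi> i j. case i of
       Inl i' \<Rightarrow> (case j of Inl j' \<Rightarrow> A $ i' $ j' | Inr j' \<Rightarrow> B $ i' $ j')
     | Inr i' \<Rightarrow> (case j of Inl j' \<Rightarrow> C $ i' $ j' | Inr j' \<Rightarrow> D $ i' $ j'))"

lemma block_matrix_nth [simp]: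
  "block_matrix A B C D $ Inl i $ Inl j = A $ i $ j"
  "block_matrix A B C D $ Inl i $ Inr j' = B $ i $ j'"
  "block_matrix A B C D $ Inr i' $ Inl j = C $ i' $ j"
  "block_matrix A B C D $ Inr i' $ Inr j' = D $ i' $ j'"
  by (simp_all add: block_matrix_def)

lemma sum_UNIV_sum_type:
  fixes g :: "'n::finite + 'm::finite \<Rightarrow> 'a::comm_monoid_add"
  shows "(\<Sum>x\<in>UNIV. g x) = (\<Sum>i\<in>UNIV. g (Inl i)) + (\<Sum>j\<in>UNIV. g (Inr j))"
  unfolding UNIV_Plus_UNIV[symmetric] by (subst sum.Plus) (simp_all add: o_def)

lemma prod_UNIV_sum_type:
  fixes g :: "'n::finite + 'm::finite \<Rightarrow> 'a::comm_monoid_mult"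
  shows "(\<Prod>x\<in>UNIV. g x) = (\<Prod>i\<in>UNIV. g (Inl i)) * (\<Prod>j\<in>UNIV. g (Inr j))"
  unfolding UNIV_Plus_UNIV[symmetric] by (subst prod.Plus) (simp_all add: o_def)

lemma block_matrix_mult:
  fixes A :: "'a::comm_ring_1^'n^'n" and D :: "'a^'m^'m"
  shows "block_matrix A B C D ** block_matrix A' B' C' D' =
    block_matrix (A ** A' + B ** C') (A ** B' + B ** D') (C ** A' + D ** C') (C ** B' + D ** D')"
proof -
  have "(block_matrix A B C D ** block_matrix A' B' C' D') $ i $ j =
    block_matrix (A ** A' + B ** C') (A ** B' + B ** D') (C ** A' + D ** C') (C ** B' + D ** D') $ i $ j"
    for i j
    by (cases i; cases j) (simp_all add: matrix_matrix_mult_def sum_UNIV_sum_type)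
  then show ?thesis by (simp add: vec_eq_iff)
qed

lemma permutes_map_sum:
  fixes q :: "'n::finite \<Rightarrow> 'n" and r :: "'m::finite \<Rightarrow> 'm"
  assumes "q permutes UNIV" "r permutes UNIV"
  shows "map_sum q r permutes UNIV"
proof -
  have "inj (map_sum q r)"
    using assms by (simp add: sum.inj_map permutes_inj)
  then have "bij (map_sum q r)" by (simp add: bij_def finite_UNIV_inj_surj)
  then show ?thesis by (simp add: permutes_univ bij_iff)
qed

text \<open>
  A permutation of one summand, extended by the identity, is the transport of that permutation along
  the injection of the summand, and transport along an injection preserves the sign.
\<close>

lemma sign_map_sum:
  fixes p :: "'n::finite \<Rightarrow> 'n" and q :: "'m::finite \<Rightarrow> 'm"
  assumes "p permutes UNIV" "q permutes UNIV"
  shows "sign (map_sum p q) = sign p * sign q"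
proof -
  have perm: "permutation (map_sum p' q')" if "p' permutes UNIV" "q' permutes UNIV"
    for p' :: "'n \<Rightarrow> 'n" and q' :: "'m \<Rightarrow> 'm"
    using permutes_map_sum[OF that] by (rule permutes_imp_permutation[OF finite])
  have "map_sum p id = map_permutation UNIV (Inl :: 'n \<Rightarrow> 'n + 'm) p"
  proof
    show "map_sum p id x = map_permutation UNIV Inl p x" for x :: "'n + 'm"
      by (cases x) (auto simp: map_permutation_def restrict_id_def)
  qed
  then have l: "sign (map_sum p id :: 'n + 'm \<Rightarrow> _) = sign p"
    using assms by (simp only: sign_map_permutation[OF inj_Inl _ finite])
  have "map_sum id q = map_permutation UNIV (Inr :: 'm \<Rightarrow> 'n + 'm) q"
  proof
    show "map_sum id q x = map_permutation UNIV Inr q x" for x :: "'n + 'm"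
      by (cases x) (auto simp: map_permutation_def restrict_id_def)
  qed
  then have r: "sign (map_sum id q :: 'n + 'm \<Rightarrow> _) = sign q"
    using assms by (simp only: sign_map_permutation[OF inj_Inr _ finite])
  have "map_sum p q = map_sum p id \<circ> map_sum id q"
    by (simp add: map_sum.comp)
  then show ?thesis
    by (simp only: sign_compose perm assms permutes_id l r)
qed

text \<open>
  By finiteness, a permutation that maps the right summand into itself maps it onto itself, which
  leaves no room there for images from the left summand.
\<close>

lemma permutes_preserving_Inr_eq_map_sum:
  fixes p :: "'n::finite + 'm::finite \<Rightarrow> 'n + 'm"
  assumes "p permutes UNIV" and "\<And>j. p (Inr j) \<in> range Inr"
  obtains q r where "q permutes UNIV" "r permutes UNIV" "p = map_sum q r"
proof -
  have bij: "bij p" using assms(1) by (rule permutes_bij)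
  have inj: "p x = p y \<Longrightarrow> x = y" for x y
    using bij by (simp add: bij_def inj_eq)
  define r where "r j = projr (p (Inr j))" for j
  have r: "p (Inr j) = Inr (r j)" for j
    using assms(2)[of j] by (auto simp: r_def)
  have "inj r"
  proof (rule injI)
    show "j = j'" if "r j = r j'" for j j'
      using inj[of "Inr j" "Inr j'"] r that by simp
  qed
  then have bijr: "bij r" by (simp add: bij_def finite_UNIV_inj_surj)
  define q where "q i = projl (p (Inl i))" for i
  have q: "p (Inl i) = Inl (q i)" for i
  proof (cases "p (Inl i)")
    case (Inr j)
    obtain j' where "r j' = j" using bij_is_surj[OF bijr] by (metis surjD)
    then have "p (Inl i) = p (Inr j')" using Inr r by simp
    then have "Inl i = Inr j'" by (rule inj)
    then show ?thesis by simp
  qed (simp add: q_def)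
  have "inj q"
  proof (rule injI)
    show "i = i'" if "q i = q i'" for i i'
      using inj[of "Inl i" "Inl i'"] q that by simp
  qed
  then have "bij q" by (simp add: bij_def finite_UNIV_inj_surj)
  moreover have "p = map_sum q r"
  proof
    show "p x = map_sum q r x" for x using q r by (cases x) simp_all
  qed
  ultimately show thesis using that bijr by (simp add: permutes_univ bij_iff)
qed

text \<open>
  In the Leibniz formula, a permutation contributes only if it sends no row of the lower blocks to a
  column of the zero block. The remaining permutations are the pairs of a permutation of the left and
  one of the right index type, and the sum over such pairs factors.
\<close>

lemma det_block_triangular:
  fixes A :: "'a::comm_ring_1^'n^'n" and D :: "'a^'m^'m"
  shows "det (block_matrix A B 0 D) = det A * det D"
proof -
  let ?M = "block_matrix A B 0 D"
  let ?P = "\<lambda>p. of_int (sign p) * (\<Prod>i\<in>UNIV. ?M $ i $ p i)"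
  let ?PN = "{p :: 'n \<Rightarrow> 'n. p permutes UNIV}" and ?PM = "{p :: 'm \<Rightarrow> 'm. p permutes UNIV}"
  let ?map = "\<lambda>(q, r). map_sum q r :: 'n + 'm \<Rightarrow> 'n + 'm"
  have inj: "inj_on ?map (?PN \<times> ?PM)"
    by (rule inj_onI) (auto simp: fun_eq_iff split_sum_all)
  have vanish: "?P p = 0" if p: "p permutes UNIV" "p \<notin> ?map ` (?PN \<times> ?PM)" for p
  proof -
    obtain j where "p (Inr j) \<notin> range Inr"
      using permutes_preserving_Inr_eq_map_sum[OF p(1)] p(2) by (metis (mono_tags, lifting)
          SigmaI case_prod_conv image_eqI mem_Collect_eq)
    then obtain i where "p (Inr j) = Inl i" by (metis obj_sumE rangeI)
    then have "?M $ Inr j $ p (Inr j) = 0" by simp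
    then have "(\<Prod>i\<in>UNIV. ?M $ i $ p i) = 0"
      by (meson UNIV_I finite prod_zero)
    then show ?thesis by simp
  qed
  have "det ?M = sum ?P {p. p permutes UNIV}"
    by (simp add: det_def)
  also have "\<dots> = sum ?P (?map ` (?PN \<times> ?PM))"
    using vanish by (intro sum.mono_neutral_right) (auto simp: permutes_map_sum)
  also have "\<dots> = (\<Sum>(q, r)\<in>?PN \<times> ?PM. ?P (map_sum q r))"
    by (subst sum.reindex[OF inj]) (simp add: case_prod_unfold o_def)
  also have "\<dots> = (\<Sum>(q, r)\<in>?PN \<times> ?PM.
      (of_int (sign q) * (\<Prod>i\<in>UNIV. A $ i $ q i)) * (of_int (sign r) * (\<Prod>i\<in>UNIV. D $ i $ r i)))"
    by (intro sum.cong) (auto simp: sign_map_sum prod_UNIV_sum_type mult_ac)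
  also have "\<dots> = det A * det D"
    by (simp add: det_def sum_product sum.cartesian_product)
  finally show ?thesis .
qed

section \<open>Exchanging the factors of a product\<close>

lemma det_mat: "det (mat x :: 'a::comm_ring_1^'n^'n) = x ^ CARD('n)"
  by (subst det_diagonal) (simp_all add: mat_def)

text \<open>
  Sylvester's determinant identity in its homogeneous form. The powers of \<open>x\<close> come from the diagonal
  blocks \<open>mat x\<close> of the two products; no division takes place, so that the identity also holds where
  \<open>x\<close> is not invertible, in particular over a polynomial ring.
\<close>

lemma det_sylvester:
  fixes A :: "'a::comm_ring_1^'m^'n" and B :: "'a^'n^'m"
  shows "x ^ CARD('m) * det (mat x - A ** B) = x ^ CARD('n) * det (mat x - B ** A)"
proof -
  let ?L = "block_matrix (mat 1) 0 (- B) (mat x)" and ?M = "block_matrix (mat x) A B (mat 1)"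
  have neg: "(- B) ** C = - (B ** C)" for C :: "'a^'i^'n"
    by (simp add: vec_eq_iff matrix_matrix_mult_def sum_negf)
  have neg': "A ** (- B) = - (A ** B)"
    by (simp add: vec_eq_iff matrix_matrix_mult_def sum_negf)
  have comm: "mat x ** C = C ** mat x" for C :: "'a^'i^'j"
    by (simp add: vec_eq_iff matrix_matrix_mult_def mat_def mult.commute
        if_distrib[of "\<lambda>a. a * _"] if_distrib[of "\<lambda>a. _ * a"] cong: if_cong)
  have prod_LM: "?L ** ?M = block_matrix (mat x) A 0 (mat x - B ** A)"
    unfolding block_matrix_mult by (simp add: neg comm[of B])
  have prod_ML: "?M ** ?L = block_matrix (mat x - A ** B) (A ** mat x) 0 (mat x)"
    unfolding block_matrix_mult by (simp add: neg')
  have "det (?L ** ?M) = det (?M ** ?L)"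
    by (simp add: det_mul mult.commute)
  then show ?thesis
    unfolding prod_LM prod_ML by (simp add: det_block_triangular det_mat mult.commute)
qed

text \<open>
  The shift by \<open>c\<close> is absorbed into the ring element \<open>x\<close> of Sylvester's identity, namely the
  linear polynomial with root \<open>c\<close>. The surplus factor is the \<open>k\<close>-th power of that polynomial, which
  is why the surplus eigenvalue is \<open>c\<close>.
\<close>

lemma eigenvalues_shifted_product:
  fixes A :: "real^'m^'n" and B :: "real^'n^'m"
  assumes "CARD('n) = CARD('m) + k"
  shows "eigenvalues (mat c + A ** B) = replicate_mset k (of_real c) + eigenvalues (mat c + B ** A)"
proof -
  let ?p = "\<lambda>M. map_matrix (\<lambda>a. [:complex_of_real a:]) M"
  let ?x = "[:- complex_of_real c, 1:]"
  have char: "charpoly (map_matrix complex_of_real (mat c + M ** M')) = det (mat ?x - ?p M ** ?p M')"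
    for M :: "real^'i^'j" and M' :: "real^'j^'i"
  proof -
    have const: "(\<Sum>l\<in>I. [:g l:]) = [:\<Sum>l\<in>I. g l:]" for g :: "'i \<Rightarrow> complex" and I
      by (induction I rule: infinite_finite_induct) simp_all
    have "mat [:0, 1:] - map_matrix (\<lambda>a. [:a:]) (map_matrix complex_of_real (mat c + M ** M'))
        = mat ?x - ?p M ** ?p M'"
      by (simp add: vec_eq_iff matrix_matrix_mult_def mat_def const mult.commute)
    then show ?thesis by (simp add: charpoly_def)
  qed
  let ?AB = "charpoly (map_matrix complex_of_real (mat c + A ** B))"
  let ?BA = "charpoly (map_matrix complex_of_real (mat c + B ** A))"
  have "?x ^ CARD('m) * ?AB = ?x ^ CARD('n) * ?BA"
    unfolding char by (rule det_sylvester)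
  also have "\<dots> = ?x ^ CARD('m) * (?x ^ k * ?BA)"
    by (simp add: assms power_add mult.assoc)
  finally have "?AB = ?x ^ k * ?BA"
    by (subst (asm) mult_cancel_left) simp
  then have "proots ?AB = proots (?x ^ k) + proots ?BA"
    by (simp only:) (rule proots_mult, simp_all add: charpoly_nonzero)
  then show ?thesis
    by (simp add: eigenvalues_def proots_power)
qed

section \<open>The Jacobian on the critical manifold\<close>

text \<open>
  A product rule in which one factor vanishes at the point and the other is merely continuous there:
  the term that would contain the derivative of \<open>g\<close> is multiplied by \<open>f z = 0\<close>.
\<close>

lemma has_derivative_prod_vanishing:
  fixes f :: "'a::real_normed_vector \<Rightarrow> 'b::real_normed_vector"
  assumes "bounded_bilinear P" and "(f has_derivative f') (at z)" and "f z = 0" and "isCont g z"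
  shows "((\<lambda>w. P (g w) (f w)) has_derivative (\<lambda>h. P (g z) (f' h))) (at z)"
proof -
  interpret P: bounded_bilinear P by fact
  interpret f': bounded_linear f' using assms(2) by (rule has_derivative_bounded_linear)
  \<comment> \<open>The difference quotient splits into the remainder of \<open>f\<close>, multiplied by a convergent factor, and
    the bounded quotient of its linear part, multiplied by a factor that tends to zero.\<close>
  let ?e = "\<lambda>w. (f w - f' (w - z)) /\<^sub>R norm (w - z)"
  let ?u = "\<lambda>w. P (g w) (?e w) + P (g w - g z) (f' (w - z) /\<^sub>R norm (w - z))"
  have e: "(?e \<longlongrightarrow> 0) (at z)"
    using assms(2,3) by (simp add: has_derivative_at_within)
  have g: "(g \<longlongrightarrow> g z) (at z)" using assms(4) by (simp add: isCont_def)
  obtain C where C: "\<And>h. norm (f' h) \<le> norm h * C"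
    using f'.bounded by blast
  have "((\<lambda>w. P (g w) (?e w)) \<longlongrightarrow> 0) (at z)"
    using P.tendsto[OF g e] by (simp add: P.zero_right)
  moreover have "((\<lambda>w. P (g w - g z) (f' (w - z) /\<^sub>R norm (w - z))) \<longlongrightarrow> 0) (at z)"
  proof -
    have "Bfun (\<lambda>w. f' (w - z) /\<^sub>R norm (w - z)) (at z)"
    proof (rule BfunI)
      show "\<forall>\<^sub>F w in at z. norm (f' (w - z) /\<^sub>R norm (w - z)) \<le> C"
        using C by (auto simp: eventually_at divide_simps mult.commute intro!: exI[of _ 1])
    qed
    moreover have "Zfun (\<lambda>w. g w - g z) (at z)"
      using g by (simp add: tendsto_Zfun_iff)
    ultimately show ?thesis
      using P.Zfun_prod_Bfun by (simp add: tendsto_Zfun_iff)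
  qed
  ultimately have "(?u \<longlongrightarrow> 0) (at z)"
    using tendsto_add by fastforce
  moreover have "?u w = (P (g w) (f w) - P (g z) (f z) - P (g z) (f' (w - z))) /\<^sub>R norm (w - z)" for w
    by (simp add: assms(3) P.zero_right P.scaleR_right P.diff_right P.diff_left scaleR_diff_right)
  ultimately show ?thesis
    by (simp add: has_derivative_at_within bounded_linear_compose[OF P.bounded_linear_right f'.bounded_linear_axioms])
qed

lemma bounded_bilinear_matrix_vector_mult:
  "bounded_bilinear ((*v) :: real^'m^'n \<Rightarrow> real^'m \<Rightarrow> real^'n)"
proof -
  have "bilinear ((*v) :: real^'m^'n \<Rightarrow> real^'m \<Rightarrow> real^'n)"
    unfolding bilinear_def
    by (auto intro!: linearI simp: matrix_vector_mult_def vec_eq_iff algebra_simps sum.distrib sum_distrib_left)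
  then show ?thesis by (simp add: bilinear_conv_bounded_bilinear)
qed

lemma jacobian_critical_point:
  fixes N :: "real^'n \<Rightarrow> real^'m^'n" and f :: "real^'n \<Rightarrow> real^'m"
  assumes "f differentiable (at z)" and "isCont N z" and "f z = 0"
  shows "jacobian (\<lambda>w. w + N w *v f w) (at z) = mat 1 + N z ** jacobian f (at z)"
proof -
  have "(f has_derivative (\<lambda>h. jacobian f (at z) *v h)) (at z)"
    using assms(1) by (simp add: jacobian_works)
  then have "((\<lambda>w. N w *v f w) has_derivative (\<lambda>h. N z *v (jacobian f (at z) *v h))) (at z)"
    using assms by (intro has_derivative_prod_vanishing[OF bounded_bilinear_matrix_vector_mult])
  then have "((\<lambda>w. w + N w *v f w) has_derivative (\<lambda>h. h + N z *v (jacobian f (at z) *v h))) (at z)"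
    by (intro has_derivative_add has_derivative_ident)
  also have "(\<lambda>h. h + N z *v (jacobian f (at z) *v h)) = (*v) (mat 1 + N z ** jacobian f (at z))"
    by (simp add: fun_eq_iff matrix_vector_mul_assoc matrix_vector_mult_add_rdistrib)
  finally show ?thesis
    unfolding jacobian_def[of "\<lambda>w. w + N w *v f w"]
    by (simp add: frechet_derivative_at[symmetric])
qed

theorem proposition2p8:
  fixes H :: "real^'n \<Rightarrow> real \<Rightarrow> real^'n"
    and N :: "real^'n \<Rightarrow> real^'m^'n"
    and f :: "real^'n \<Rightarrow> real^'m"
    and G :: "real^'n \<Rightarrow> real \<Rightarrow> real^'n"
    and S :: "(real^'n) set"
    and k :: nat and r :: enat and \<epsilon>\<^sub>0 :: real
  assumes "1 \<le> k" and "k < CARD('n)" and "CARD('m) = CARD('n) - k"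
    and "1 \<le> r" and "0 < \<epsilon>\<^sub>0"
    and "\<forall>z. \<forall>\<epsilon>\<in>{0..<\<epsilon>\<^sub>0}. H z \<epsilon> = z + N z *v f z + \<epsilon> *\<^sub>R G z \<epsilon>"
    and "C_smooth_on r (UNIV \<times> {0..<\<epsilon>\<^sub>0}) (\<lambda>(z, \<epsilon>). H z \<epsilon>)"
    and "\<forall>z\<in>S. f differentiable (at z)"
    and "\<forall>z\<in>S. isCont N z"
    and "assumption1 r k N f S"
    and "assumption2 N f S"
  shows "\<forall>z\<in>S.
      nontrivial_eigenvalues k (N z ** jacobian f (at z)) = eigenvalues (jacobian f (at z) ** N z) \<and>
      jacobian (\<lambda>w. H w 0) (at z) = mat 1 + N z ** jacobian f (at z) \<and>
      nontrivial_multipliers k (jacobian (\<lambda>w. H w 0) (at z)) =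
        eigenvalues (mat 1 + jacobian f (at z) ** N z)"
proof
  fix z assume z: "z \<in> S"
  let ?Df = "jacobian f (at z)"
  have card: "CARD('n) = CARD('m) + k"
    using assms(2,3) by simp
  have "f z = 0"
    using assms(11) z by (auto simp: assumption2_def)
  moreover have "H w 0 = w + N w *v f w" for w
    using assms(5,6) by simp
  ultimately have jac: "jacobian (\<lambda>w. H w 0) (at z) = mat 1 + N z ** ?Df"
    using jacobian_critical_point[of f z N] assms(8,9) z by simp
  have mat_0: "mat 0 + M = M" for M :: "real^'i^'i"
    by (simp add: vec_eq_iff mat_def)
  have "nontrivial_eigenvalues k (N z ** ?Df) = eigenvalues (?Df ** N z)"
    using eigenvalues_shifted_product[OF card, of 0 "N z" ?Df]
    by (simp add: nontrivial_eigenvalues_def mat_0)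
  moreover have "nontrivial_multipliers k (mat 1 + N z ** ?Df) = eigenvalues (mat 1 + ?Df ** N z)"
    using eigenvalues_shifted_product[OF card, of 1 "N z" ?Df]
    by (simp add: nontrivial_multipliers_def)
  ultimately show "nontrivial_eigenvalues k (N z ** ?Df) = eigenvalues (?Df ** N z) \<and>
      jacobian (\<lambda>w. H w 0) (at z) = mat 1 + N z ** ?Df \<and>
      nontrivial_multipliers k (jacobian (\<lambda>w. H w 0) (at z)) = eigenvalues (mat 1 + ?Df ** N z)"
    by (simp add: jac)
qed

end
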